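(* Assume that the functions $f_1,\dots,f_n:\mathbb{R}^d\to\mathbb{R}$ are differentiable. Let $\mathbf{x}^\star\in\arg\min_{\mathbf{x}\in\mathbb{R}^d}F(\mathbf{x})$ with $\nabla F(\mathbf{x}^\star)=0$, and $\mathbf{x}_\lambda^\star\in\arg\min_{\mathbf{x}\in\mathbb{R}^d}L_\lambda(\mathbf{x})$ with $\nabla L_\lambda(\mathbf{x}_\lambda^\star)=0$. Furthermore, suppose there exist at least two indices $1\le i,j\le n$ such that $f_i(\mathbf{x})\ne f_j(\mathbf{x})$ and $\nabla f_i(\mathbf{x})\neq\nabla f_j(\mathbf{x})$ for $\mathbf{x}\in\{\mathbf{x}^\star,\mathbf{x}_\lambda^\star\}$. Let $\mathcal{G}(\mathbf{x})=\{\nabla f_i(\mathbf{x})\}_{i=1}^n$ denote the set of gradient vectors at $\mathbf{x}$. Then $$\nabla L_\lambda(\mathbf{x}^\star)\neq0\quad\text{and}\quad\nabla F(\mathbf{x}_\lambda^\star)\ne0$$ if at least one of the following conditions holds: 1. Subset of clients with distinct gradient directions, others with identical loss values. That is, there exist $m$ linearly independent gradients in $\mathcal{G}(\mathbf{x})$, where $1<m\le n-1$, and the remaining $n-m$ gradients correspond to loss functions that are equal at $\mathbf{x}\in\{\mathbf{x}^\star,\mathbf{x}_\lambda^\star\}$. Specifically, if $I_{\mathrm{ind}}\subseteq\{1,\dots,n\}$ indexes the $m$ linearly independent gradients, i.e. $\mathcal{G}_{\mathrm{ind}}(\mathbf{x})=\{\nabla f_i(\mathbf{x})\mid i\in I_{\mathrm{ind}}\}\subseteq\mathcal{G}(\mathbf{x})$,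 and the remaining indices are $I_{\mathrm{rem}}=\{1,\dots,n\}\setminus I_{\mathrm{ind}}$, then the corresponding loss values satisfy $f_j(\mathbf{x})=f_k(\mathbf{x})$ for all $j,k\in I_{\mathrm{rem}}$. 2. Subset of clients with non-zero gradients, all but one sharing the same loss value. That is, there exist $m$ non-zero gradient vectors with $1\le m\le n$, and the loss functions corresponding to these gradients are all equal except for one.
   Context: $n$ is the number of clients and $f_i$ is the local loss function of client $i$. $F(\mathbf{x})=\frac1n\sum_{i=1}^n f_i(\mathbf{x})$ is the average loss and $L_\lambda(\mathbf{x})=F(\mathbf{x})+\frac{\lambda}{2n}\sum_{i=1}^n\big(f_i(\mathbf{x})-F(\mathbf{x})\big)^2$ is the loss-variance-regularized objective, where $\lambda$ is a tunable parameter controlling the degree of fairness (setting it to zero gives back $F$).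
   Formalization: λ is assumed non-zero, since for λ = 0 we have L_λ = F and the claim fails; in condition 2 the m non-zero gradients are taken to be all the non-zero gradients at the point, since the claim fails if further non-zero gradients are unconstrained. *)

theory Defs
  imports "HOL-Analysis.Analysis"
begin

definition gradient :: "('a::real_inner \<Rightarrow> real) \<Rightarrow> 'a \<Rightarrow> 'a" where
  "gradient g x = (THE D. GDERIV g x :> D)"

lemma gradient_eqI:
  assumes "GDERIV g x :> D"
  shows "gradient g x = D"
proof -
  have "D' = D" if "GDERIV g x :> D'" for D'
  proof -
    have "(\<lambda>h. inner h D') = (\<lambda>h. inner h D)"
      using that assms unfolding gderiv_def by (rule has_derivative_unique)
    then show ?thesis
      by (metis vector_eq_ldot)
  qed
  with assms show ?thesis
    unfolding gradient_def by (rule the_equality)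
qed

lemma GDERIV_gradient:
  fixes g :: "'a::euclidean_space \<Rightarrow> real"
  assumes "g differentiable (at x)"
  shows "GDERIV g x :> gradient g x"
proof -
  obtain g' where g': "(g has_derivative g') (at x)"
    using assms unfolding differentiable_def by blast
  then have lin: "linear g'"
    by (rule has_derivative_linear)
  have "g' = (\<lambda>h. inner h (adjoint g' 1))"
    by (simp add: adjoint_works[OF lin] fun_eq_iff)
  with g' have "GDERIV g x :> adjoint g' 1"
    unfolding gderiv_def by simp
  with gradient_eqI show ?thesis by metis
qed

definition avg_loss :: "nat \<Rightarrow> (nat \<Rightarrow> 'a \<Rightarrow> real) \<Rightarrow> 'a \<Rightarrow> real" where
  "avg_loss n f x = (1 / real n) * (\<Sum>i=1..n. f i x)"

definition fair_loss :: "real \<Rightarrow> nat \<Rightarrow> (nat \<Rightarrow> 'a \<Rightarrow> real) \<Rightarrow> 'a \<Rightarrow> real" where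
  "fair_loss lam n f x =
     avg_loss n f x + lam / (2 * real n) * (\<Sum>i=1..n. (f i x - avg_loss n f x)\<^sup>2)"

text \<open>Linear independence is that of the indexed family, hence the injectivity: \<open>independent\<close>
  alone would not notice a vector repeated under two indices.\<close>

definition indep_rest_equal ::
    "nat \<Rightarrow> (nat \<Rightarrow> 'a::real_inner \<Rightarrow> real) \<Rightarrow> 'a \<Rightarrow> bool" where
  "indep_rest_equal n f x \<longleftrightarrow>
     (\<exists>m I. 1 < m \<and> m \<le> n - 1 \<and> I \<subseteq> {1..n} \<and> card I = m \<and>
        inj_on (\<lambda>i. gradient (f i) x) I \<and>
        independent ((\<lambda>i. gradient (f i) x) ` I) \<and>
        (\<forall>j\<in>{1..n} - I. \<forall>k\<in>{1..n} - I. f j x = f k x))"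

text \<open>The \<open>m\<close> non-zero gradients are all the non-zero gradients at \<open>x\<close>. The exceptional
  loss value \<open>f k x\<close> really differs from the common value \<open>c\<close> of the others; for
  \<open>m = 1\<close> there are no others and the requirement on the values is void.\<close>

definition nonzero_all_but_one_equal ::
    "nat \<Rightarrow> (nat \<Rightarrow> 'a::real_inner \<Rightarrow> real) \<Rightarrow> 'a \<Rightarrow> bool" where
  "nonzero_all_but_one_equal n f x \<longleftrightarrow>
     (\<exists>m I. 1 \<le> m \<and> m \<le> n \<and> I = {i \<in> {1..n}. gradient (f i) x \<noteq> 0} \<and> card I = m \<and>
        (\<exists>k\<in>I. \<exists>c. f k x \<noteq> c \<and> (\<forall>i\<in>I - {k}. f i x = c)))"

end

theory Submission
  imports Defs
begin

text \<open>Since the deviations \<open>f\<^sub>i - F\<close> sum to zero, the gradient of \<open>L\<^sub>\<lambda>\<close> is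
  \<open>\<nabla>F + (\<lambda>/n) \<Sum>\<^sub>i (f\<^sub>i - F) \<nabla>f\<^sub>i\<close>. Hence at a common critical point of \<open>F\<close> and
  \<open>L\<^sub>\<lambda>\<close> both \<open>\<Sum>\<^sub>i \<nabla>f\<^sub>i\<close> and \<open>\<Sum>\<^sub>i f\<^sub>i \<nabla>f\<^sub>i\<close> vanish, so \<open>\<Sum>\<^sub>i (f\<^sub>i - c) \<nabla>f\<^sub>i = 0\<close> for
  every constant \<open>c\<close>. Take for \<open>c\<close> the loss value shared by all but the independent gradients
  (condition 1), respectively by all but one of the non-zero ones (condition 2). Only the terms of
  the exceptional clients survive, so independence forces all losses to be equal, respectively
  the single remaining term is non-zero.\<close>

lemma sum_deviation_avg_loss:
  assumes "n > 0"
  shows "(\<Sum>i=1..n. f i x - avg_loss n f x) = 0"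
  using assms by (simp add: sum_subtractf avg_loss_def)

lemma GDERIV_avg_loss:
  fixes f :: "nat \<Rightarrow> 'a::real_inner \<Rightarrow> real"
  assumes "\<And>i. i \<in> {1..n} \<Longrightarrow> GDERIV (f i) x :> g i"
  shows "GDERIV (avg_loss n f) x :> (1 / real n) *\<^sub>R (\<Sum>i=1..n. g i)"
proof -
  have "((\<lambda>y. (1 / real n) * (\<Sum>i=1..n. f i y)) has_derivative
         (\<lambda>h. (1 / real n) * (\<Sum>i=1..n. inner h (g i)))) (at x)"
    by (intro has_derivative_mult_right has_derivative_sum)
      (use assms in \<open>auto simp: gderiv_def\<close>)
  then show ?thesis
    unfolding gderiv_def by (simp add: avg_loss_def[abs_def] inner_sum_right)
qed

lemma GDERIV_fair_loss:
  fixes f :: "nat \<Rightarrow> 'a::real_inner \<Rightarrow> real"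
  assumes n: "n > 0"
    and f: "\<And>i. i \<in> {1..n} \<Longrightarrow> GDERIV (f i) x :> g i"
  shows "GDERIV (fair_loss lam n f) x :>
    (1 / real n) *\<^sub>R (\<Sum>i=1..n. g i) +
    (lam / real n) *\<^sub>R (\<Sum>i=1..n. (f i x - avg_loss n f x) *\<^sub>R g i)"
proof -
  let ?F = "avg_loss n f" and ?G = "(1 / real n) *\<^sub>R (\<Sum>i=1..n. g i)"
  let ?d = "\<lambda>i. f i x - ?F x"
  have F: "(?F has_derivative (\<lambda>h. inner h ?G)) (at x)"
    using GDERIV_avg_loss[OF f] by (simp add: gderiv_def)
  \<comment> \<open>The product stays expanded so that the part with \<open>?G\<close>, which comes
    from differentiating the mean, can be summed separately and cancels.\<close>
  have sq: "((\<lambda>y. (f i y - ?F y)\<^sup>2) has_derivative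
        (\<lambda>h. 2 * (?d i * inner h (g i) - ?d i * inner h ?G))) (at x)" if "i \<in> {1..n}" for i
  proof -
    have "(f i has_derivative (\<lambda>h. inner h (g i))) (at x)"
      using f[OF that] by (simp add: gderiv_def)
    from has_derivative_power[OF has_derivative_diff[OF this F], of 2] show ?thesis
      by (simp add: algebra_simps)
  qed
  have "(fair_loss lam n f has_derivative
     (\<lambda>h. inner h ?G + lam / (2 * real n) *
        (\<Sum>i=1..n. 2 * (?d i * inner h (g i) - ?d i * inner h ?G)))) (at x)"
    unfolding fair_loss_def[abs_def]
    by (intro has_derivative_add F has_derivative_mult_right has_derivative_sum sq)
  moreover have "(\<Sum>i=1..n. 2 * (?d i * inner h (g i) - ?d i * inner h ?G)) =
      2 * inner h (\<Sum>i=1..n. ?d i *\<^sub>R g i)" for h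
  proof -
    have "(\<Sum>i=1..n. ?d i * inner h ?G) = 0"
      using sum_deviation_avg_loss[OF n, of f x] by (metis sum_distrib_right mult_zero_left)
    then show ?thesis
      by (simp only: sum_distrib_left[symmetric] sum_subtractf inner_sum_right inner_scaleR_right)
        simp
  qed
  ultimately show ?thesis
    by (simp add: gderiv_def inner_add_right)
qed

lemma common_critical_point:
  fixes f :: "nat \<Rightarrow> 'a::euclidean_space \<Rightarrow> real"
  assumes n: "n > 0" and lam: "lam \<noteq> 0"
    and diff: "\<And>i. i \<in> {1..n} \<Longrightarrow> f i differentiable (at x)"
    and F: "gradient (avg_loss n f) x = 0"
    and L: "gradient (fair_loss lam n f) x = 0"
  shows "(\<Sum>i=1..n. (f i x - c) *\<^sub>R gradient (f i) x) = 0"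
proof -
  let ?g = "\<lambda>i. gradient (f i) x"
  have g: "GDERIV (f i) x :> ?g i" if "i \<in> {1..n}" for i
    by (rule GDERIV_gradient[OF diff[OF that]])
  have s: "(\<Sum>i=1..n. ?g i) = 0"
    using gradient_eqI[OF GDERIV_avg_loss[OF g]] F n by simp
  have "(\<Sum>i=1..n. (f i x - avg_loss n f x) *\<^sub>R ?g i) = 0"
    using gradient_eqI[OF GDERIV_fair_loss[OF n g]] L n lam s by simp
  with s show ?thesis
    by (simp add: scaleR_left_diff_distrib sum_subtractf scaleR_sum_right[symmetric])
qed

lemma indep_rest_equal_imp_constant:
  fixes f :: "nat \<Rightarrow> 'a::real_inner \<Rightarrow> real"
  assumes cond: "indep_rest_equal n f x"
    and zero: "\<And>c. (\<Sum>i=1..n. (f i x - c) *\<^sub>R gradient (f i) x) = 0"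
  shows "\<exists>c. \<forall>i\<in>{1..n}. f i x = c"
proof -
  let ?g = "\<lambda>i. gradient (f i) x"
  obtain I where I: "1 < card I" "card I \<le> n - 1" "I \<subseteq> {1..n}" "inj_on ?g I"
    "independent (?g ` I)"
    and rest: "\<And>j k. j \<in> {1..n} - I \<Longrightarrow> k \<in> {1..n} - I \<Longrightarrow> f j x = f k x"
    using cond unfolding indep_rest_equal_def by blast
  \<comment> \<open>Subtraction on naturals truncates: \<open>1 < card I\<close> forces
    \<open>n > 0\<close>, so \<open>n - 1\<close> really is less than \<open>n\<close>.\<close>
  have "I \<noteq> {1..n}"
    using I(1,2) by auto
  with I(3) obtain j where j: "j \<in> {1..n} - I"
    by blast
  have fin: "finite I"
    using I(3) finite_subset by blast
  \<comment> \<open>The constant is the loss of the remaining client \<open>j\<close>, so every term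
    outside \<open>I\<close> vanishes.\<close>
  have "(\<Sum>i\<in>I. (f i x - f j x) *\<^sub>R ?g i) = (\<Sum>i=1..n. (f i x - f j x) *\<^sub>R ?g i)"
    by (rule sum.mono_neutral_left) (use I(3) rest[OF _ j] in auto)
  then have "(\<Sum>i\<in>I. (f i x - f j x) *\<^sub>R ?g i) = 0"
    using zero by simp
  \<comment> \<open>\<open>independentD\<close> wants coefficients indexed by vectors, so the
    weights are carried over along the inverse of \<open>?g\<close> on \<open>I\<close>.\<close>
  then have "(\<Sum>v\<in>?g ` I. (f (the_inv_into I ?g v) x - f j x) *\<^sub>R v) = 0"
    by (simp add: sum.reindex[OF I(4)] the_inv_into_f_f[OF I(4)])
  then have "f i x = f j x" if "i \<in> I" for i
    using independentD[OF I(5) finite_imageI[OF fin] subset_refl, of _ "?g i"] that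
    by (fastforce simp: the_inv_into_f_f[OF I(4)])
  with rest j show ?thesis
    by blast
qed

lemma not_nonzero_all_but_one_equal:
  fixes f :: "nat \<Rightarrow> 'a::real_inner \<Rightarrow> real"
  assumes zero: "\<And>c. (\<Sum>i=1..n. (f i x - c) *\<^sub>R gradient (f i) x) = 0"
  shows "\<not> nonzero_all_but_one_equal n f x"
proof
  let ?g = "\<lambda>i. gradient (f i) x"
  assume "nonzero_all_but_one_equal n f x"
  then obtain k c where k: "k \<in> {1..n}" "?g k \<noteq> 0" "f k x \<noteq> c"
    and c: "\<And>i. i \<in> {1..n} \<Longrightarrow> ?g i \<noteq> 0 \<Longrightarrow> i \<noteq> k \<Longrightarrow> f i x = c"
    unfolding nonzero_all_but_one_equal_def by blast
  \<comment> \<open>A client other than \<open>k\<close> has zero gradient or loss \<open>c\<close>;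
    either way its term is zero.\<close>
  have "(\<Sum>i\<in>{k}. (f i x - c) *\<^sub>R ?g i) = (\<Sum>i=1..n. (f i x - c) *\<^sub>R ?g i)"
    by (rule sum.mono_neutral_left) (use k(1) c in auto)
  with zero k show False
    by simp
qed

theorem theorem3:
  fixes f :: "nat \<Rightarrow> real ^ 'd \<Rightarrow> real"
    and n :: nat
    and lam :: real
    and xs xl :: "real ^ 'd"
  assumes "lam \<noteq> 0"
    and "\<And>i x. i \<in> {1..n} \<Longrightarrow> f i differentiable (at x)"
    and "is_arg_min (avg_loss n f) (\<lambda>_. True) xs"
    and "gradient (avg_loss n f) xs = 0"
    and "is_arg_min (fair_loss lam n f) (\<lambda>_. True) xl"
    and "gradient (fair_loss lam n f) xl = 0"
    and "\<exists>i\<in>{1..n}. \<exists>j\<in>{1..n}. \<forall>x\<in>{xs, xl}.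
           f i x \<noteq> f j x \<and> gradient (f i) x \<noteq> gradient (f j) x"
    and "(\<forall>x\<in>{xs, xl}. indep_rest_equal n f x) \<or>
         (\<forall>x\<in>{xs, xl}. nonzero_all_but_one_equal n f x)"
  shows "gradient (fair_loss lam n f) xs \<noteq> 0 \<and> gradient (avg_loss n f) xl \<noteq> 0"
proof -
  have n: "n > 0"
    using assms(7) by auto
  \<comment> \<open>Both claims follow once neither point is critical for both objectives, since
    each is already critical for one.\<close>
  have "\<not> (gradient (avg_loss n f) x = 0 \<and> gradient (fair_loss lam n f) x = 0)"
    if x: "x \<in> {xs, xl}" for x
  proof
    assume "gradient (avg_loss n f) x = 0 \<and> gradient (fair_loss lam n f) x = 0"
    then have zero: "(\<Sum>i=1..n. (f i x - c) *\<^sub>R gradient (f i) x) = 0" for c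
      by (intro common_critical_point[OF n assms(1)] assms(2)) auto
    \<comment> \<open>The second condition is impossible here, which leaves the first; it makes all
      losses equal, against the two clients with distinct losses.\<close>
    then have "indep_rest_equal n f x"
      using assms(8) not_nonzero_all_but_one_equal x by blast
    then obtain c where "\<forall>i\<in>{1..n}. f i x = c"
      using indep_rest_equal_imp_constant zero by blast
    with assms(7) x show False
      by metis
  qed
  with assms(4,6) show ?thesis
    by blast
qed

end
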